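(* Let $E$ be a non-empty set and let $\Phi:E\times E\to\mathbb{R}$ be symmetric, i.e. $\Phi(r,s)=\Phi(s,r)$ for all $r,s\in E$. Let $\mathcal{C}^\Phi:\bar{\mathbb{R}}^E\to\bar{\mathbb{R}}^E$ be the associated generalized conjugation. Let $g\in\bar{\mathbb{R}}^E$. 1. If $\mathcal{C}^\Phi g\leq g$, then there exists $h\in\bar{\mathbb{R}}^E$ such that $\mathcal{C}^\Phi g\leq \mathcal{C}^\Phi h=h\leq g$. 2. If $g\in\mathcal{C}^\Phi(\bar{\mathbb{R}}^E)$ and $g\leq\mathcal{C}^\Phi g$, then there exists $h\in\bar{\mathbb{R}}^E$ such that $g\leq\mathcal{C}^\Phi h=h\leq\mathcal{C}^\Phi g$. In particular, there exists $h\in\bar{\mathbb{R}}^E$ with $h=\mathcal{C}^\Phi h$.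
   Context: $\bar{\mathbb{R}}=\mathbb{R}\cup\{-\infty,\infty\}$, and $\bar{\mathbb{R}}^E$ is the set of all functions $E\to\bar{\mathbb{R}}$, ordered pointwise ($f\le h$ means $f(r)\le h(r)$ for all $r\in E$). For symmetric $\Phi:E\times E\to\mathbb{R}$, the generalized conjugation $\mathcal{C}^\Phi:\bar{\mathbb{R}}^E\to\bar{\mathbb{R}}^E$ is $\mathcal{C}^\Phi h(s)=\sup_{r\in E}\{\Phi(r,s)-h(r)\}$. $\mathcal{C}^\Phi(\bar{\mathbb{R}}^E)$ denotes the image of $\mathcal{C}^\Phi$. *)

theory Defs
  imports Complex_Main "HOL-Library.Extended_Real" "HOL-Library.FuncSet"
begin

text \<open>
  A set \<open>E\<close> is an explicit carrier \<open>E :: 'a set\<close>.  Functions on \<open>E\<close> are represented by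
  HOL functions that take the value \<open>undefined\<close> outside \<open>E\<close>, so that equality in HOL coincides
  with equality of functions on \<open>E\<close>.
\<close>

definition ext_real_functions :: "'a set \<Rightarrow> ('a \<Rightarrow> ereal) set" where
  "ext_real_functions E = E \<rightarrow>\<^sub>E UNIV"

definition le_fun_on :: "'a set \<Rightarrow> ('a \<Rightarrow> ereal) \<Rightarrow> ('a \<Rightarrow> ereal) \<Rightarrow> bool" where
  "le_fun_on E f h \<longleftrightarrow> (\<forall>r\<in>E. f r \<le> h r)"

definition symmetric_on :: "'a set \<Rightarrow> ('a \<Rightarrow> 'a \<Rightarrow> real) \<Rightarrow> bool" where
  "symmetric_on E \<Phi> \<longleftrightarrow> (\<forall>r\<in>E. \<forall>s\<in>E. \<Phi> r s = \<Phi> s r)"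

text \<open>
  Since \<open>\<Phi>\<close> is real-valued, the difference below is never of the form \<open>\<infinity> - \<infinity>\<close>.
\<close>

definition conjugation :: "'a set \<Rightarrow> ('a \<Rightarrow> 'a \<Rightarrow> real) \<Rightarrow> ('a \<Rightarrow> ereal) \<Rightarrow> ('a \<Rightarrow> ereal)" where
  "conjugation E \<Phi> h = (\<lambda>s\<in>E. SUP r\<in>E. ereal (\<Phi> r s) - h r)"

end

theory Submission
  imports Defs
begin

text \<open>
  By symmetry of \<open>\<Phi>\<close>, conjugation is an antitone Galois connection with itself.  Every chain of
  functions \<open>h\<close> with \<open>\<C> h \<le> h \<le> g\<close> has its pointwise infimum again of this kind, so Zorn's lemma
  gives a minimal one.  If \<open>\<C> h s < h s\<close> held at some point \<open>s\<close>, then the value of \<open>h\<close> at \<open>s\<close>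
  could be lowered to \<open>max (\<C> h s) (\<Phi> s s / 2)\<close>, contradicting minimality.  The second part is
  the first one applied to \<open>\<C> g\<close>, since \<open>\<C> (\<C> g) = g\<close> for \<open>g\<close> in the image of \<open>\<C>\<close>.
\<close>

text \<open>Finiteness of \<open>a\<close> keeps both differences meaningful when \<open>x\<close>
  or \<open>y\<close> is infinite; in terms of \<open>x + y\<close>, opposite infinities would need
  a convention.\<close>

lemma ereal_diff_le_commute: "ereal a - x \<le> y \<longleftrightarrow> ereal a - y \<le> x"
  by (cases x; cases y) auto

lemma le_fun_on_refl: "le_fun_on E f f"
  by (simp add: le_fun_on_def)

lemma le_fun_on_trans: "le_fun_on E f g \<Longrightarrow> le_fun_on E g h \<Longrightarrow> le_fun_on E f h"
  unfolding le_fun_on_def by (meson order_trans)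

lemma le_fun_on_antisym:
  assumes "f \<in> ext_real_functions E" "h \<in> ext_real_functions E"
    and "le_fun_on E f h" "le_fun_on E h f"
  shows "f = h"
  using assms unfolding ext_real_functions_def le_fun_on_def
  by (intro PiE_ext[of f E "\<lambda>_. UNIV" h]) (auto intro: antisym)

lemma conjugation_in_ext_real_functions: "conjugation E \<Phi> h \<in> ext_real_functions E"
  by (auto simp: conjugation_def ext_real_functions_def)

lemma conjugation_le_iff:
  "le_fun_on E (conjugation E \<Phi> f) h \<longleftrightarrow> (\<forall>r\<in>E. \<forall>s\<in>E. ereal (\<Phi> r s) - f r \<le> h s)"
  by (auto simp: le_fun_on_def conjugation_def SUP_le_iff)

text \<open>Both sides are families of inequalities over pairs from \<open>E\<close>; by symmetry of
  \<Phi>, the one at \<open>(r, s)\<close> on the left is the one at \<open>(s, r)\<close> on the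
  right.\<close>

lemma conjugation_galois:
  assumes "symmetric_on E \<Phi>"
  shows "le_fun_on E (conjugation E \<Phi> f) h \<longleftrightarrow> le_fun_on E (conjugation E \<Phi> h) f"
proof -
  have "ereal (\<Phi> r s) - f r \<le> h s \<longleftrightarrow> ereal (\<Phi> s r) - h s \<le> f r" if "r \<in> E" "s \<in> E" for r s
    using assms that ereal_diff_le_commute[of "\<Phi> r s"] by (simp add: symmetric_on_def)
  then show ?thesis
    unfolding conjugation_le_iff by blast
qed

lemma conjugation_antimono:
  assumes "le_fun_on E f h"
  shows "le_fun_on E (conjugation E \<Phi> h) (conjugation E \<Phi> f)"
  using assms unfolding le_fun_on_def conjugation_def
  by (auto intro!: SUP_mono ereal_minus_mono)

text \<open>Double conjugates lie below the original. At \<open>f\<close>, antitonicity turns this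
  into one inequality; at the conjugate of \<open>f\<close> it is the other.\<close>

lemma conjugation_triple:
  assumes "symmetric_on E \<Phi>"
  shows "conjugation E \<Phi> (conjugation E \<Phi> (conjugation E \<Phi> f)) = conjugation E \<Phi> f"
proof -
  have "le_fun_on E (conjugation E \<Phi> (conjugation E \<Phi> h)) h" for h
    using conjugation_galois[OF assms] le_fun_on_refl by blast
  then show ?thesis
    using le_fun_on_antisym[OF conjugation_in_ext_real_functions conjugation_in_ext_real_functions]
      conjugation_antimono by blast
qed

text \<open>The conjugate of each member lies below all members, hence below \<open>u\<close>; the
  Galois connection then puts the conjugate of \<open>u\<close> below each member, hence below
  \<open>u\<close>.\<close>

lemma conjugation_le_inf_chain:
  assumes chain: "\<And>h k. h \<in> C \<Longrightarrow> k \<in> C \<Longrightarrow> le_fun_on E h k \<or> le_fun_on E k h"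
    and self: "\<And>h. h \<in> C \<Longrightarrow> le_fun_on E (conjugation E \<Phi> h) h"
    and sym: "symmetric_on E \<Phi>"
  defines "u \<equiv> \<lambda>s\<in>E. INF h\<in>C. h s"
  shows "le_fun_on E (conjugation E \<Phi> u) u"
proof -
  \<comment> \<open>If \<open>h \<le> k\<close>, go through \<open>h\<close>; if
    \<open>k \<le> h\<close>, go through the conjugate of \<open>k\<close>.\<close>
  have pair: "le_fun_on E (conjugation E \<Phi> h) k" if "h \<in> C" "k \<in> C" for h k
    using chain[OF that] self that conjugation_antimono le_fun_on_trans by blast
  have le_u: "le_fun_on E f u" if "\<And>h. h \<in> C \<Longrightarrow> le_fun_on E f h" for f
    using that by (auto simp: u_def le_fun_on_def intro: INF_greatest)
  have "le_fun_on E (conjugation E \<Phi> u) k" if "k \<in> C" for k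
    unfolding conjugation_galois[OF sym, of u] using le_u pair that by blast
  then show ?thesis
    using le_u by blast
qed

text \<open>Only pairs containing \<open>s\<close> are affected. The first bound in
  \<open>ge\<close> handles those with one entry \<open>s\<close>; the pair \<open>(s, s)\<close>
  demands \<open>\<Phi> s s - v \<le> v\<close>, which is the second bound.\<close>

lemma conjugation_lower_value:
  assumes sym: "symmetric_on E \<Phi>" and s: "s \<in> E"
    and self: "le_fun_on E (conjugation E \<Phi> h) h"
    and ge: "conjugation E \<Phi> h s \<le> v" "ereal (\<Phi> s s / 2) \<le> v"
  shows "le_fun_on E (conjugation E \<Phi> (h(s := v))) (h(s := v))"
  unfolding conjugation_le_iff
proof (intro ballI)
  fix r t assume rt: "r \<in> E" "t \<in> E"
  have at_s: "ereal (\<Phi> x s) - h x \<le> v" if "x \<in> E" for x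
    using that ge(1) s unfolding conjugation_def
    by (simp add: SUP_le_iff)
  have \<Phi>: "\<Phi> s t = \<Phi> t s"
    using sym s rt unfolding symmetric_on_def by blast
  consider "r = s" "t = s" | "r = s" "t \<noteq> s" | "r \<noteq> s" "t = s" | "r \<noteq> s" "t \<noteq> s"
    by blast
  then show "ereal (\<Phi> r t) - (h(s := v)) r \<le> (h(s := v)) t"
  proof cases
    case 1
    then show ?thesis using ge(2) by (cases v) auto
  next
    case 2
    then show ?thesis using at_s[OF rt(2)] \<Phi> ereal_diff_le_commute by auto
  next
    case 3
    then show ?thesis using at_s[OF rt(1)] by simp
  next
    case 4
    then show ?thesis using self rt unfolding conjugation_le_iff by simp
  qed
qed

lemma conjugation_fixed_if_minimal:
  assumes sym: "symmetric_on E \<Phi>" and h: "h \<in> ext_real_functions E"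
    and self: "le_fun_on E (conjugation E \<Phi> h) h"
    and minimal: "\<And>k. k \<in> ext_real_functions E \<Longrightarrow> le_fun_on E (conjugation E \<Phi> k) k \<Longrightarrow>
      le_fun_on E k h \<Longrightarrow> k = h"
  shows "conjugation E \<Phi> h = h"
proof (rule le_fun_on_antisym[OF conjugation_in_ext_real_functions h self])
  show "le_fun_on E h (conjugation E \<Phi> h)"
    unfolding le_fun_on_def
  proof (rule ballI, rule ccontr)
    fix s assume s: "s \<in> E" and "\<not> h s \<le> conjugation E \<Phi> h s"
    then have less: "conjugation E \<Phi> h s < h s" by simp
    \<comment> \<open>The term \<open>r = s\<close> of the supremum gives
      \<open>\<Phi> s s - h s < h s\<close>, so half of \<open>\<Phi> s s\<close> is below
      \<open>h s\<close>.\<close>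
    have "ereal (\<Phi> s s) - h s \<le> conjugation E \<Phi> h s"
      using s unfolding conjugation_def by (auto intro: SUP_upper)
    with less have half: "ereal (\<Phi> s s / 2) < h s"
      by (cases "h s"; cases "conjugation E \<Phi> h s") auto
    define v where "v = max (conjugation E \<Phi> h s) (ereal (\<Phi> s s / 2))"
    have v: "v < h s" using less half by (simp add: v_def)
    have "h(s := v) = h"
    proof (rule minimal)
      show "h(s := v) \<in> ext_real_functions E"
        using h s unfolding ext_real_functions_def by (auto simp: PiE_iff extensional_def)
      show "le_fun_on E (conjugation E \<Phi> (h(s := v))) (h(s := v))"
        by (rule conjugation_lower_value[OF sym s self]) (simp_all add: v_def)
      show "le_fun_on E (h(s := v)) h"
        using v by (simp add: le_fun_on_def less_imp_le)
    qed
    then show False using v by (metis fun_upd_same less_irrefl)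
  qed
qed

lemma conjugation_fixed_point_below:
  assumes sym: "symmetric_on E \<Phi>" and g: "g \<in> ext_real_functions E"
    and self: "le_fun_on E (conjugation E \<Phi> g) g"
  obtains h where "h \<in> ext_real_functions E" "conjugation E \<Phi> h = h" "le_fun_on E h g"
proof -
  define A where "A = {h \<in> ext_real_functions E. le_fun_on E (conjugation E \<Phi> h) h \<and> le_fun_on E h g}"
  \<comment> \<open>The order is reversed because Zorn's lemma yields maximal elements.\<close>
  define P where "P = (\<lambda>h k. le_fun_on E k h)"
  have "partial_order_on A (relation_of P A)"
  proof (rule partial_order_on_relation_ofI)
    show "P a a" for a
      by (simp add: P_def le_fun_on_refl)
    show "P a c" if "P a b" "P b c" for a b c
      using that le_fun_on_trans unfolding P_def by blast
    show "a = b" if "a \<in> A" "b \<in> A" "P a b" "P b a" for a b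
      using that le_fun_on_antisym unfolding P_def A_def by blast
  qed
  moreover have "\<exists>u\<in>A. \<forall>a\<in>C. P a u" if C: "C \<in> Chains (relation_of P A)" for C
  proof (cases "C = {}")
    \<comment> \<open>The empty infimum is \<infinity>, which need not lie below \<open>g\<close>,
      so \<open>g\<close> itself serves as the bound.\<close>
    case True
    then show ?thesis using g self le_fun_on_refl by (auto simp: A_def)
  next
    case False
    have CA: "C \<subseteq> A" and chain: "\<And>h k. h \<in> C \<Longrightarrow> k \<in> C \<Longrightarrow> le_fun_on E h k \<or> le_fun_on E k h"
      using C unfolding Chains_def relation_of_def P_def by blast+
    define u where "u = (\<lambda>s\<in>E. INF h\<in>C. h s)"
    have lower: "le_fun_on E u h" if "h \<in> C" for h
      using that by (auto simp: u_def le_fun_on_def intro: INF_lower)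
    have "le_fun_on E u g"
      using False CA lower le_fun_on_trans unfolding A_def by blast
    moreover have "le_fun_on E (conjugation E \<Phi> u) u"
      unfolding u_def using conjugation_le_inf_chain[OF chain _ sym] CA unfolding A_def by blast
    moreover have "u \<in> ext_real_functions E"
      by (simp add: u_def ext_real_functions_def)
    ultimately show ?thesis using lower unfolding A_def P_def by blast
  qed
  ultimately obtain h where h: "h \<in> A" and min: "\<And>k. k \<in> A \<Longrightarrow> P h k \<Longrightarrow> k = h"
    using predicate_Zorn[of A P] by blast
  have "conjugation E \<Phi> h = h"
  proof (rule conjugation_fixed_if_minimal[OF sym])
    \<comment> \<open>Minimality within \<open>A\<close> suffices: such a \<open>k\<close> lies
      below \<open>h\<close>, hence below \<open>g\<close>, and so belongs to
      \<open>A\<close>.\<close>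
    show "k = h" if "k \<in> ext_real_functions E" "le_fun_on E (conjugation E \<Phi> k) k" "le_fun_on E k h" for k
      using min[of k] that h le_fun_on_trans unfolding A_def P_def by blast
  qed (use h in \<open>auto simp: A_def\<close>)
  then show thesis using h that unfolding A_def by blast
qed

theorem theorem1p1:
  fixes E :: "'a set" and \<Phi> :: "'a \<Rightarrow> 'a \<Rightarrow> real"
  assumes "E \<noteq> {}" and "symmetric_on E \<Phi>"
  shows "(\<forall>g \<in> ext_real_functions E.
            (le_fun_on E (conjugation E \<Phi> g) g \<longrightarrow>
              (\<exists>h \<in> ext_real_functions E.
                 le_fun_on E (conjugation E \<Phi> g) (conjugation E \<Phi> h) \<and>
                 conjugation E \<Phi> h = h \<and> le_fun_on E h g)) \<and>
            (g \<in> conjugation E \<Phi> ` ext_real_functions E \<and>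
             le_fun_on E g (conjugation E \<Phi> g) \<longrightarrow>
              (\<exists>h \<in> ext_real_functions E.
                 le_fun_on E g (conjugation E \<Phi> h) \<and>
                 conjugation E \<Phi> h = h \<and> le_fun_on E h (conjugation E \<Phi> g)))) \<and>
         (\<exists>h \<in> ext_real_functions E. h = conjugation E \<Phi> h)"
proof -
  have below: "\<exists>h\<in>ext_real_functions E. le_fun_on E (conjugation E \<Phi> g) (conjugation E \<Phi> h) \<and>
      conjugation E \<Phi> h = h \<and> le_fun_on E h g"
    if g: "g \<in> ext_real_functions E" "le_fun_on E (conjugation E \<Phi> g) g" for g
  proof -
    obtain h where h: "h \<in> ext_real_functions E" "conjugation E \<Phi> h = h" "le_fun_on E h g"
      using conjugation_fixed_point_below[OF assms(2) g] .
    then show ?thesis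
      by (intro bexI[of _ h] conjI conjugation_antimono)
  qed
  show ?thesis
  proof (intro conjI ballI impI)
    fix g assume "g \<in> ext_real_functions E" "le_fun_on E (conjugation E \<Phi> g) g"
    then show "\<exists>h\<in>ext_real_functions E. le_fun_on E (conjugation E \<Phi> g) (conjugation E \<Phi> h) \<and>
        conjugation E \<Phi> h = h \<and> le_fun_on E h g"
      by (rule below)
  next
    fix g assume g: "g \<in> conjugation E \<Phi> ` ext_real_functions E \<and> le_fun_on E g (conjugation E \<Phi> g)"
    then have biconj: "conjugation E \<Phi> (conjugation E \<Phi> g) = g"
      using conjugation_triple[OF assms(2)] by auto
    show "\<exists>h\<in>ext_real_functions E. le_fun_on E g (conjugation E \<Phi> h) \<and>
        conjugation E \<Phi> h = h \<and> le_fun_on E h (conjugation E \<Phi> g)"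
      \<comment> \<open>By \<open>biconj\<close>, the premise of \<open>below\<close> for the
        conjugate of \<open>g\<close> is exactly the assumed inequality.\<close>
      using below[OF conjugation_in_ext_real_functions, of \<Phi> g] g unfolding biconj by blast
  next
    \<comment> \<open>The constant \<infinity> dominates every function on \<open>E\<close>, in
      particular its own conjugate.\<close>
    have "(\<lambda>s\<in>E. \<infinity>) \<in> ext_real_functions E"
      by (simp add: ext_real_functions_def)
    moreover have "le_fun_on E (conjugation E \<Phi> (\<lambda>s\<in>E. \<infinity>)) (\<lambda>s\<in>E. \<infinity>)"
      by (simp add: le_fun_on_def)
    ultimately obtain h where "h \<in> ext_real_functions E" "conjugation E \<Phi> h = h"
      using below by blast
    then show "\<exists>h\<in>ext_real_functions E. h = conjugation E \<Phi> h"
      by (intro bexI[of _ h]) simp_all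
  qed
qed

end
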